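(* Let $(X,d)$ be a metric space and let $\mathcal{S}$ be a bornology on $X$. Suppose for any $S\in\mathcal{S}$ no Lipschitz enlargement of $S$ is equal to $X$, i.e. $B_d(S,f)\neq X$ for all $S\in\mathcal{S}$ and $f\in L(\mathcal{Z}^+)$. Consider the following statements: (i) for all $S\in\mathcal{S}$ and $f,g\in L(\mathcal{Z}^+)$ with $\inf_{x\in S}(g(x)-f(x))>0$, there exist $S_1,\ldots,S_n\in\mathcal{S}$ and $0<\alpha_i<\epsilon_i$, $i=1,\ldots,n$, such that $\max_{1\leq i\leq n}2\epsilon_i<\inf_{x\in S}(g(x)-f(x))$ and $$B_d(S,f)\subseteq\bigcup_{i=1}^nB_d(S_i,\alpha_i)\subseteq\bigcup_{i=1}^nB_d(S_i,\epsilon_i)\subseteq B_d(S,g);$$ (ii) $\tau_{\mathcal{S},d}^+=\mathsf{G}_{\mathcal{S},d}^+$ and $\tau_{\mathcal{S},d}^-=\mathcal{LE}_{\mathcal{S},d}^-$ on $CL(X)$; (iii) $\tau_{\mathcal{S},d}=\tau_{GE}^{\mathcal{S}}$ on $CL(X)$. Then (i) $\Rightarrow$ (ii) $\Rightarrow$ (iii).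
   Context: A bornology on a metric space $(X,d)$ is a nonempty family $\mathcal{S}$ of nonempty subsets of $X$ that is hereditary (nonempty subsets of members are members), stable under finite unions, and covers $X$. $CL(X)$ is the collection of all nonempty closed subsets of $X$. $d(x,A)=\inf_{a\in A}d(x,a)$; $B_d(x,r)$ is the open ball of radius $r$; for $\epsilon>0$, $B_d(A,\epsilon)=\{x\in X: d(x,A)<\epsilon\}$. $L(\mathcal{Z}^+)$ is the set of all Lipschitz functions $f:X\to\mathbb{R}$ with $f(x)>0$ for all $x\in X$. For such $f$ and $S\subseteq X$, the Lipschitz enlargement is $B_d(S,f)=\bigcup_{x\in S}B_d(x,f(x))$. Gap: $D_d(S,A)=\inf\{d(x,a):x\in S,\ a\in A\}$. Excess: $e_d(S,A)=\sup_{x\in S}d(x,A)\in[0,\infty]$. The upper gap convergence $\mathsf{G}_{\mathcal{S},d}^+$ is convergence in the weakest topology on $CL(X)$ for which each $D_d(S,\cdot)$, $S\in\mathcal{S}$, is lower semicontinuous. The lower left excess convergence $\mathcal{LE}_{\mathcal{S},d}^-$ is convergence in the weakest topology on $CL(X)$ for which each $e_d(S,\cdot)$, $S\in\mathcal{S}$, is upper semicontinuous. The gap and excess convergence $\tau_{GE}^{\mathcal{S}}$ is convergence in the weakest topology on $CL(X)$ for which all $D_d(S,\cdot)$ and $e_d(S,\cdot)$, $S\in\mathcal{S}$, are continuous. A net $(A_\lambda)$ is $\tau_{\mathcal{S},d}^-$-convergent (resp. $\tau_{\mathcal{S},d}^+$-convergent) to $A$ if for every $\epsilon>0$ and $S\in\mathcal{S}$,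 eventually $d(x,A_\lambda)-d(x,A)<\epsilon$ (resp. $d(x,A)-d(x,A_\lambda)<\epsilon$) for all $x\in S$; it is $\tau_{\mathcal{S},d}$-convergent to $A$ if both hold. Equality of two convergences on $CL(X)$ means that they have the same convergent nets in $CL(X)$ with the same limits in $CL(X)$. *)

theory Defs
  imports "HOL-Analysis.Analysis"
begin

text \<open>The metric space \<open>(X, d)\<close> is a type of class \<open>metric_space\<close>, with \<open>d = dist\<close> and
  \<open>X = UNIV\<close>.  The distance from a point to a set is \<^const>\<open>infdist\<close>, and the gap between
  two sets is \<^const>\<open>setdist\<close>; both are only used for nonempty sets, where they are the
  usual infima.\<close>

definition bornology :: "'a::metric_space set set \<Rightarrow> bool" where
  "bornology \<S> \<longleftrightarrow>
     \<S> \<noteq> {} \<and> {} \<notin> \<S> \<and>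
     (\<forall>S\<in>\<S>. \<forall>T. T \<subseteq> S \<longrightarrow> T \<noteq> {} \<longrightarrow> T \<in> \<S>) \<and>
     (\<forall>\<F>. finite \<F> \<longrightarrow> \<F> \<noteq> {} \<longrightarrow> \<F> \<subseteq> \<S> \<longrightarrow> \<Union>\<F> \<in> \<S>) \<and>
     \<Union>\<S> = UNIV"

definition CL :: "'a::metric_space set set" where
  "CL = {A. closed A \<and> A \<noteq> {}}"

definition positive_lipschitz :: "('a::metric_space \<Rightarrow> real) set" where
  "positive_lipschitz = {f. (\<exists>L. L-lipschitz_on UNIV f) \<and> (\<forall>x. f x > 0)}"

definition enlargement :: "'a::metric_space set \<Rightarrow> real \<Rightarrow> 'a set" where
  "enlargement A \<epsilon> = {x. infdist x A < \<epsilon>}"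

definition lipschitz_enlargement :: "'a::metric_space set \<Rightarrow> ('a \<Rightarrow> real) \<Rightarrow> 'a set" where
  "lipschitz_enlargement S f = (\<Union>x\<in>S. ball x (f x))"

definition excess :: "'a::metric_space set \<Rightarrow> 'a set \<Rightarrow> ereal" where
  "excess S A = (SUP x\<in>S. ereal (infdist x A))"


subsection \<open>Weak topologies on the hyperspace\<close>

definition lsc_map :: "'b topology \<Rightarrow> ('b \<Rightarrow> 'c::linorder) \<Rightarrow> bool" where
  "lsc_map T f \<longleftrightarrow> (\<forall>\<alpha>. openin T {A \<in> topspace T. \<alpha> < f A})"

definition usc_map :: "'b topology \<Rightarrow> ('b \<Rightarrow> 'c::linorder) \<Rightarrow> bool" where
  "usc_map T f \<longleftrightarrow> (\<forall>\<alpha>. openin T {A \<in> topspace T. f A < \<alpha>})"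

text \<open>The intersection of all topologies on \<open>C\<close> with property \<open>P\<close>.  It need not itself have
  property \<open>P\<close> in general; that it does in the three cases used here is proved below.\<close>

definition weakest_topology :: "'b set \<Rightarrow> ('b topology \<Rightarrow> bool) \<Rightarrow> 'b topology" where
  "weakest_topology C P = topology (\<lambda>U. \<forall>T. topspace T = C \<and> P T \<longrightarrow> openin T U)"

definition upper_gap_topology :: "'a::metric_space set set \<Rightarrow> 'a set topology" where
  "upper_gap_topology \<S> = weakest_topology CL (\<lambda>T. \<forall>S\<in>\<S>. lsc_map T (setdist S))"

definition lower_excess_topology :: "'a::metric_space set set \<Rightarrow> 'a set topology" where
  "lower_excess_topology \<S> = weakest_topology CL (\<lambda>T. \<forall>S\<in>\<S>. usc_map T (excess S))"

definition gap_excess_topology :: "'a::metric_space set set \<Rightarrow> 'a set topology" where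
  "gap_excess_topology \<S> = weakest_topology CL
     (\<lambda>T. \<forall>S\<in>\<S>. continuous_map T euclidean (setdist S) \<and> continuous_map T euclidean (excess S))"


subsection \<open>Nets and convergences\<close>

definition directed_by :: "'i set \<Rightarrow> ('i \<Rightarrow> 'i \<Rightarrow> bool) \<Rightarrow> bool" where
  "directed_by I le \<longleftrightarrow>
     I \<noteq> {} \<and> (\<forall>i\<in>I. le i i) \<and>
     (\<forall>i\<in>I. \<forall>j\<in>I. \<forall>k\<in>I. le i j \<longrightarrow> le j k \<longrightarrow> le i k) \<and>
     (\<forall>i\<in>I. \<forall>j\<in>I. \<exists>k\<in>I. le i k \<and> le j k)"

text \<open>The filter of tails of a directed set; see \<open>eventually_net_filter\<close> below.\<close>

definition net_filter :: "'i set \<Rightarrow> ('i \<Rightarrow> 'i \<Rightarrow> bool) \<Rightarrow> 'i filter" where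
  "net_filter I le = (INF i\<in>I. principal {j \<in> I. le i j})"

type_synonym ('i, 'a) convergence = "'i filter \<Rightarrow> ('i \<Rightarrow> 'a set) \<Rightarrow> 'a set \<Rightarrow> bool"

definition lower_conv :: "'a::metric_space set set \<Rightarrow> ('i, 'a) convergence" where
  "lower_conv \<S> F A L \<longleftrightarrow>
     (\<forall>\<epsilon>>0. \<forall>S\<in>\<S>. \<forall>\<^sub>F i in F. \<forall>x\<in>S. infdist x (A i) - infdist x L < \<epsilon>)"

definition upper_conv :: "'a::metric_space set set \<Rightarrow> ('i, 'a) convergence" where
  "upper_conv \<S> F A L \<longleftrightarrow>
     (\<forall>\<epsilon>>0. \<forall>S\<in>\<S>. \<forall>\<^sub>F i in F. \<forall>x\<in>S. infdist x L - infdist x (A i) < \<epsilon>)"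

definition two_sided_conv :: "'a::metric_space set set \<Rightarrow> ('i, 'a) convergence" where
  "two_sided_conv \<S> F A L \<longleftrightarrow> lower_conv \<S> F A L \<and> upper_conv \<S> F A L"

definition topology_conv :: "'a set topology \<Rightarrow> ('i, 'a) convergence" where
  "topology_conv T F A L \<longleftrightarrow> limitin T A L F"

text \<open>Equality of two convergences on \<open>CL\<close>, tested on all nets whose directed index set is a
  set of elements of type \<open>'i\<close>.  Types cannot be quantified inside a formula, so the index
  type is a parameter, and a theorem is meant to hold for every \<open>'i\<close>.\<close>

definition conv_eq ::
  "'i itself \<Rightarrow> ('i, 'a::metric_space) convergence \<Rightarrow> ('i, 'a) convergence \<Rightarrow> bool" where
  "conv_eq _ c c' \<longleftrightarrow>
     (\<forall>I le A L. directed_by I le \<longrightarrow> (\<forall>i\<in>I. A i \<in> CL) \<longrightarrow> L \<in> CL \<longrightarrow>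
        (c (net_filter I le) A L \<longleftrightarrow> c' (net_filter I le) A L))"


subsection \<open>Adequacy of the encodings\<close>

lemma eventually_net_filter:
  assumes "directed_by I le"
  shows "eventually P (net_filter I le) \<longleftrightarrow> (\<exists>i\<in>I. \<forall>j\<in>I. le i j \<longrightarrow> P j)"
proof -
  have "I \<noteq> {}"
    using assms unfolding directed_by_def by iprover
  moreover have "\<exists>k\<in>I. principal {l\<in>I. le k l} \<le> inf (principal {l\<in>I. le i l}) (principal {l\<in>I. le j l})"
    if ij: "i \<in> I" "j \<in> I" for i j
  proof -
    have trans: "\<forall>i\<in>I. \<forall>j\<in>I. \<forall>k\<in>I. le i j \<longrightarrow> le j k \<longrightarrow> le i k"
      and ub: "\<forall>i\<in>I. \<forall>j\<in>I. \<exists>k\<in>I. le i k \<and> le j k"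
      using assms unfolding directed_by_def by iprover+
    from ub ij obtain k where k: "k \<in> I" "le i k" "le j k"
      by blast
    have "le i l \<and> le j l" if "l \<in> I" "le k l" for l
      using trans[rule_format, OF ij(1) k(1) that(1) k(2) that(2)]
        trans[rule_format, OF ij(2) k(1) that(1) k(3) that(2)] ..
    then have "{l\<in>I. le k l} \<subseteq> {l\<in>I. le i l} \<inter> {l\<in>I. le j l}"
      by blast
    with k(1) show ?thesis
      by (intro bexI[of _ k]) simp_all
  qed
  ultimately have "eventually P (net_filter I le) \<longleftrightarrow> (\<exists>i\<in>I. eventually P (principal {j\<in>I. le i j}))"
    unfolding net_filter_def by (rule eventually_INF_base)
  then show ?thesis
    by (simp add: eventually_principal Ball_def imp_conjL)
qed

lemma openin_weakest_topology:
  "openin (weakest_topology C P) U \<longleftrightarrow> (\<forall>T. topspace T = C \<and> P T \<longrightarrow> openin T U)"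
proof -
  have "istopology (\<lambda>U. \<forall>T. topspace T = C \<and> P T \<longrightarrow> openin T U)"
    unfolding istopology_def
  proof (intro conjI allI impI)
    fix U V T
    assume "\<forall>T. topspace T = C \<and> P T \<longrightarrow> openin T U"
      and "\<forall>T. topspace T = C \<and> P T \<longrightarrow> openin T V" and "topspace T = C \<and> P T"
    then show "openin T (U \<inter> V)"
      by (intro openin_Int) simp_all
  next
    fix \<U> T
    assume "\<forall>U\<in>\<U>. \<forall>T. topspace T = C \<and> P T \<longrightarrow> openin T U" and "topspace T = C \<and> P T"
    then show "openin T (\<Union>\<U>)"
      by (intro openin_Union) simp_all
  qed
  then show ?thesis
    by (simp add: weakest_topology_def)
qed

lemma topspace_weakest_topology:
  assumes "P (discrete_topology C)"
  shows "topspace (weakest_topology C P) = C"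
proof
  have "openin (weakest_topology C P) (topspace (weakest_topology C P))"
    by simp
  then have "openin (discrete_topology C) (topspace (weakest_topology C P))"
    using assms unfolding openin_weakest_topology
    by (elim allE[of _ "discrete_topology C"]) (simp only: topspace_discrete_topology simp_thms)
  then show "topspace (weakest_topology C P) \<subseteq> C"
    by simp
  have "openin (weakest_topology C P) C"
    unfolding openin_weakest_topology by blast
  then show "C \<subseteq> topspace (weakest_topology C P)"
    by (rule openin_subset)
qed

lemma upper_gap_topology:
  fixes \<S> :: "'a::metric_space set set"
  shows "topspace (upper_gap_topology \<S>) = CL"
    and "S \<in> \<S> \<Longrightarrow> lsc_map (upper_gap_topology \<S>) (setdist S)"
proof -
  show ts: "topspace (upper_gap_topology \<S>) = CL"
    unfolding upper_gap_topology_def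
    by (rule topspace_weakest_topology) (simp add: lsc_map_def)
  assume S: "S \<in> \<S>"
  have "openin (upper_gap_topology \<S>) {A \<in> CL. \<alpha> < setdist S A}" for \<alpha>
    unfolding upper_gap_topology_def openin_weakest_topology
  proof (intro allI impI, elim conjE)
    fix T :: "'a set topology"
    assume T: "topspace T = CL" and "\<forall>S\<in>\<S>. lsc_map T (setdist S)"
    with S have "lsc_map T (setdist S)"
      by blast
    then show "openin T {A \<in> CL. \<alpha> < setdist S A}"
      unfolding lsc_map_def T by blast
  qed
  then show "lsc_map (upper_gap_topology \<S>) (setdist S)"
    unfolding lsc_map_def ts by blast
qed

lemma lower_excess_topology:
  fixes \<S> :: "'a::metric_space set set"
  shows "topspace (lower_excess_topology \<S>) = CL"
    and "S \<in> \<S> \<Longrightarrow> usc_map (lower_excess_topology \<S>) (excess S)"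
proof -
  show ts: "topspace (lower_excess_topology \<S>) = CL"
    unfolding lower_excess_topology_def
    by (rule topspace_weakest_topology) (simp add: usc_map_def)
  assume S: "S \<in> \<S>"
  have "openin (lower_excess_topology \<S>) {A \<in> CL. excess S A < \<alpha>}" for \<alpha>
    unfolding lower_excess_topology_def openin_weakest_topology
  proof (intro allI impI, elim conjE)
    fix T :: "'a set topology"
    assume T: "topspace T = CL" and "\<forall>S\<in>\<S>. usc_map T (excess S)"
    with S have "usc_map T (excess S)"
      by blast
    then show "openin T {A \<in> CL. excess S A < \<alpha>}"
      unfolding usc_map_def T by blast
  qed
  then show "usc_map (lower_excess_topology \<S>) (excess S)"
    unfolding usc_map_def ts by blast
qed

lemma gap_excess_topology:
  fixes \<S> :: "'a::metric_space set set"
  shows "topspace (gap_excess_topology \<S>) = CL"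
    and "S \<in> \<S> \<Longrightarrow> continuous_map (gap_excess_topology \<S>) euclidean (setdist S)"
    and "S \<in> \<S> \<Longrightarrow> continuous_map (gap_excess_topology \<S>) euclidean (excess S)"
proof -
  show ts: "topspace (gap_excess_topology \<S>) = CL"
    unfolding gap_excess_topology_def
    by (rule topspace_weakest_topology) simp
  assume S: "S \<in> \<S>"
  have D: "openin (gap_excess_topology \<S>) {A \<in> CL. setdist S A \<in> U}" if "open U" for U
    unfolding gap_excess_topology_def openin_weakest_topology
  proof (intro allI impI, elim conjE)
    fix T :: "'a set topology"
    assume T: "topspace T = CL" and "\<forall>S\<in>\<S>.
      continuous_map T euclidean (setdist S) \<and> continuous_map T euclidean (excess S)"
    with S have "continuous_map T euclidean (setdist S)"
      by blast
    with that show "openin T {A \<in> CL. setdist S A \<in> U}"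
      by (simp add: continuous_map_def T)
  qed
  have E: "openin (gap_excess_topology \<S>) {A \<in> CL. excess S A \<in> U}" if "open U" for U
    unfolding gap_excess_topology_def openin_weakest_topology
  proof (intro allI impI, elim conjE)
    fix T :: "'a set topology"
    assume T: "topspace T = CL" and "\<forall>S\<in>\<S>.
      continuous_map T euclidean (setdist S) \<and> continuous_map T euclidean (excess S)"
    with S have "continuous_map T euclidean (excess S)"
      by blast
    with that show "openin T {A \<in> CL. excess S A \<in> U}"
      by (simp add: continuous_map_def T)
  qed
  show "continuous_map (gap_excess_topology \<S>) euclidean (setdist S)"
    using D by (simp add: continuous_map_def ts)
  show "continuous_map (gap_excess_topology \<S>) euclidean (excess S)"
    using E by (simp add: continuous_map_def ts)
qed

end

theory Submission
  imports Defs
begin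

text \<open>
  Uniform one-sided estimates of \<open>d(x, A\<^sub>\<lambda>)\<close> against \<open>d(x, A)\<close> on \<open>S\<close> pass to infima and suprema over
  \<open>S\<close>; this gives every implication from \<open>\<tau>\<close>-convergence to gap or excess convergence.

  For the converse of the upper half, discard the points of \<open>S\<close> with \<open>d(x, A) < \<epsilon>\<close> and put
  \<open>g(x) = max (d(x, A)) \<epsilon>\<close> and \<open>f = g - \<epsilon>/2\<close>.  The enlargement by \<open>g\<close> misses \<open>A\<close>, so all interpolating
  sets \<open>S\<^sub>i\<close> have gap at least \<open>\<epsilon>\<^sub>i > \<alpha>\<^sub>i\<close> from \<open>A\<close>; eventually their gap from \<open>A\<^sub>\<lambda>\<close> exceeds \<open>\<alpha>\<^sub>i\<close>, so
  \<open>A\<^sub>\<lambda>\<close> misses the enlargement by \<open>f\<close>.  For the lower half put \<open>f(x) = d(x, A) + \<epsilon>/4\<close> and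
  \<open>g = f + \<epsilon>/2\<close>.  A point of \<open>A\<close> within \<open>f(x)\<close> of \<open>x\<close> is \<open>\<alpha>\<^sub>i\<close>-close to some point of \<open>S\<^sub>i\<close> lying in
  \<open>{s \<in> S\<^sub>i. d(s, A) < \<alpha>\<^sub>i}\<close>.  The excess of that set over \<open>A\<^sub>\<lambda>\<close> is eventually below \<open>\<epsilon>\<^sub>i\<close>, so \<open>A\<^sub>\<lambda>\<close> has a
  point within \<open>f(x) + 2\<epsilon>\<^sub>i\<close> of \<open>x\<close>.
\<close>

subsection \<open>Convergence in weak topologies\<close>

text \<open>The finest topology on \<open>C\<close> in which \<open>A\<close> converges to \<open>L\<close>.  A weakest topology is coarser as
  soon as this one has the defining property, which makes subbases unnecessary.\<close>

definition convergence_topology :: "'b set \<Rightarrow> ('i \<Rightarrow> 'b) \<Rightarrow> 'b \<Rightarrow> 'i filter \<Rightarrow> 'b topology" where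
  "convergence_topology C A L F =
     topology (\<lambda>U. U \<subseteq> C \<and> (L \<in> U \<longrightarrow> (\<forall>\<^sub>F i in F. A i \<in> U)))"

lemma openin_convergence_topology:
  "openin (convergence_topology C A L F) U \<longleftrightarrow>
     U \<subseteq> C \<and> (L \<in> U \<longrightarrow> (\<forall>\<^sub>F i in F. A i \<in> U))"
proof -
  have "istopology (\<lambda>U. U \<subseteq> C \<and> (L \<in> U \<longrightarrow> (\<forall>\<^sub>F i in F. A i \<in> U)))"
    unfolding istopology_def
  proof (intro conjI allI impI)
    fix \<U> assume *: "\<forall>U\<in>\<U>. U \<subseteq> C \<and> (L \<in> U \<longrightarrow> (\<forall>\<^sub>F i in F. A i \<in> U))"
    then show "\<Union>\<U> \<subseteq> C"
      by blast
    assume "L \<in> \<Union>\<U>"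
    with * obtain U where "U \<in> \<U>" "\<forall>\<^sub>F i in F. A i \<in> U"
      by blast
    then show "\<forall>\<^sub>F i in F. A i \<in> \<Union>\<U>"
      by (auto elim: eventually_mono)
  qed (auto intro: eventually_conj)
  then show ?thesis
    by (simp add: convergence_topology_def)
qed

lemma topspace_convergence_topology:
  assumes "\<forall>\<^sub>F i in F. A i \<in> C"
  shows "topspace (convergence_topology C A L F) = C"
proof
  show "topspace (convergence_topology C A L F) \<subseteq> C"
    using openin_topspace[of "convergence_topology C A L F"]
    unfolding openin_convergence_topology ..
  show "C \<subseteq> topspace (convergence_topology C A L F)"
    using assms by (intro openin_subset) (simp add: openin_convergence_topology)
qed

text \<open>An open set of the weakest topology is open in every topology on \<open>C\<close> with
  \<open>P\<close>, in particular in the convergence topology, where an open set containing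
  \<open>L\<close> eventually contains the net.\<close>

lemma limitin_weakest_topology:
  assumes "L \<in> topspace (weakest_topology C P)" and ev: "\<forall>\<^sub>F i in F. A i \<in> C"
    and P: "P (convergence_topology C A L F)"
  shows "limitin (weakest_topology C P) A L F"
  unfolding limitin_def
proof (intro conjI allI impI)
  fix U assume U: "openin (weakest_topology C P) U \<and> L \<in> U"
  then have "openin (convergence_topology C A L F) U"
    using P topspace_convergence_topology[OF ev] unfolding openin_weakest_topology by blast
  with U show "\<forall>\<^sub>F i in F. A i \<in> U"
    by (simp add: openin_convergence_topology)
qed (rule assms)

section \<open>Net convergence in the three hyperspace topologies\<close>

lemma limitin_lsc_map:
  assumes "limitin T A L F" "lsc_map T h" "a < h L"
  shows "\<forall>\<^sub>F i in F. a < h (A i)"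
proof -
  have "\<forall>\<^sub>F i in F. A i \<in> {x \<in> topspace T. a < h x}"
    using assms unfolding limitin_def lsc_map_def by blast
  then show ?thesis
    by (rule eventually_mono) simp
qed

lemma limitin_usc_map:
  assumes "limitin T A L F" "usc_map T h" "h L < a"
  shows "\<forall>\<^sub>F i in F. h (A i) < a"
proof -
  have "\<forall>\<^sub>F i in F. A i \<in> {x \<in> topspace T. h x < a}"
    using assms unfolding limitin_def usc_map_def by blast
  then show ?thesis
    by (rule eventually_mono) simp
qed

text \<open>Forwards this is semicontinuity at \<open>L\<close>. Backwards, the eventual
  inequalities say that the strict superlevel sets of each gap functional are open in the
  convergence topology, so the weakest topology is coarser. The next two criteria follow the same
  pattern.\<close>

lemma limitin_upper_gap_topology:
  assumes "L \<in> CL" and ev: "\<forall>\<^sub>F i in F. A i \<in> CL"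
  shows "limitin (upper_gap_topology \<S>) A L F \<longleftrightarrow>
    (\<forall>S\<in>\<S>. \<forall>a < setdist S L. \<forall>\<^sub>F i in F. a < setdist S (A i))"
proof
  assume "limitin (upper_gap_topology \<S>) A L F"
  then show "\<forall>S\<in>\<S>. \<forall>a < setdist S L. \<forall>\<^sub>F i in F. a < setdist S (A i)"
    by (intro ballI allI impI) (rule limitin_lsc_map[OF _ upper_gap_topology(2)])
next
  assume *: "\<forall>S\<in>\<S>. \<forall>a < setdist S L. \<forall>\<^sub>F i in F. a < setdist S (A i)"
  show "limitin (upper_gap_topology \<S>) A L F"
    unfolding upper_gap_topology_def
  proof (rule limitin_weakest_topology[OF _ ev])
    show "\<forall>S\<in>\<S>. lsc_map (convergence_topology CL A L F) (setdist S)"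
      unfolding lsc_map_def topspace_convergence_topology[OF ev]
    proof (intro ballI allI)
      fix S a assume "S \<in> \<S>"
      with * have "a < setdist S L \<Longrightarrow> \<forall>\<^sub>F i in F. a < setdist S (A i)"
        by simp
      with ev show "openin (convergence_topology CL A L F) {K \<in> CL. a < setdist S K}"
        by (simp add: openin_convergence_topology eventually_conj_iff Collect_restrict)
    qed
  qed (unfold upper_gap_topology_def[symmetric] upper_gap_topology(1), rule \<open>L \<in> CL\<close>)
qed

lemma limitin_lower_excess_topology:
  assumes "L \<in> CL" and ev: "\<forall>\<^sub>F i in F. A i \<in> CL"
  shows "limitin (lower_excess_topology \<S>) A L F \<longleftrightarrow>
    (\<forall>S\<in>\<S>. \<forall>a > excess S L. \<forall>\<^sub>F i in F. excess S (A i) < a)"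
proof
  assume "limitin (lower_excess_topology \<S>) A L F"
  then show "\<forall>S\<in>\<S>. \<forall>a > excess S L. \<forall>\<^sub>F i in F. excess S (A i) < a"
    by (intro ballI allI impI) (rule limitin_usc_map[OF _ lower_excess_topology(2)])
next
  assume *: "\<forall>S\<in>\<S>. \<forall>a > excess S L. \<forall>\<^sub>F i in F. excess S (A i) < a"
  show "limitin (lower_excess_topology \<S>) A L F"
    unfolding lower_excess_topology_def
  proof (rule limitin_weakest_topology[OF _ ev])
    show "\<forall>S\<in>\<S>. usc_map (convergence_topology CL A L F) (excess S)"
      unfolding usc_map_def topspace_convergence_topology[OF ev]
    proof (intro ballI allI)
      fix S a assume "S \<in> \<S>"
      with * have "excess S L < a \<Longrightarrow> \<forall>\<^sub>F i in F. excess S (A i) < a"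
        by simp
      with ev show "openin (convergence_topology CL A L F) {K \<in> CL. excess S K < a}"
        by (simp add: openin_convergence_topology eventually_conj_iff Collect_restrict)
    qed
  qed (unfold lower_excess_topology_def[symmetric] lower_excess_topology(1), rule \<open>L \<in> CL\<close>)
qed

lemma limitin_gap_excess_topology:
  assumes "L \<in> CL" and ev: "\<forall>\<^sub>F i in F. A i \<in> CL"
  shows "limitin (gap_excess_topology \<S>) A L F \<longleftrightarrow>
    (\<forall>S\<in>\<S>. ((\<lambda>i. setdist S (A i)) \<longlongrightarrow> setdist S L) F \<and>
            ((\<lambda>i. excess S (A i)) \<longlongrightarrow> excess S L) F)"
proof
  assume lim: "limitin (gap_excess_topology \<S>) A L F"
  show "\<forall>S\<in>\<S>. ((\<lambda>i. setdist S (A i)) \<longlongrightarrow> setdist S L) F \<and>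
            ((\<lambda>i. excess S (A i)) \<longlongrightarrow> excess S L) F"
  proof
    fix S assume S: "S \<in> \<S>"
    show "((\<lambda>i. setdist S (A i)) \<longlongrightarrow> setdist S L) F \<and>
          ((\<lambda>i. excess S (A i)) \<longlongrightarrow> excess S L) F"
      using continuous_map_limit[OF gap_excess_topology(2)[OF S] lim]
        continuous_map_limit[OF gap_excess_topology(3)[OF S] lim]
      unfolding limitin_canonical_iff comp_def ..
  qed
next
  assume *: "\<forall>S\<in>\<S>. ((\<lambda>i. setdist S (A i)) \<longlongrightarrow> setdist S L) F \<and>
            ((\<lambda>i. excess S (A i)) \<longlongrightarrow> excess S L) F"
  show "limitin (gap_excess_topology \<S>) A L F"
    unfolding gap_excess_topology_def
  proof (rule limitin_weakest_topology[OF _ ev])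
    show "\<forall>S\<in>\<S>. continuous_map (convergence_topology CL A L F) euclidean (setdist S) \<and>
                 continuous_map (convergence_topology CL A L F) euclidean (excess S)"
    proof (intro ballI conjI)
      \<comment> \<open>The target space stays generic because gaps are real while excesses are
        extended real.\<close>
      have cont: "continuous_map (convergence_topology CL A L F) euclidean h"
        if "((\<lambda>i. h (A i)) \<longlongrightarrow> h L) F" for h :: "'a set \<Rightarrow> 'c::topological_space"
        using that ev unfolding continuous_map_def topspace_convergence_topology[OF ev]
        by (simp add: openin_convergence_topology tendsto_def eventually_conj_iff Collect_restrict)
      fix S assume "S \<in> \<S>"
      with * show "continuous_map (convergence_topology CL A L F) euclidean (setdist S)"
        and "continuous_map (convergence_topology CL A L F) euclidean (excess S)"
        by (blast intro: cont)+
    qed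
  qed (unfold gap_excess_topology_def[symmetric] gap_excess_topology(1), rule \<open>L \<in> CL\<close>)
qed

lemma eventually_net_filter_CL:
  assumes "directed_by I le" "\<forall>i\<in>I. A i \<in> CL"
  shows "\<forall>\<^sub>F i in net_filter I le. A i \<in> CL"
proof -
  from assms(1) have "I \<noteq> {}"
    unfolding directed_by_def by iprover
  with assms show ?thesis
    unfolding eventually_net_filter[OF assms(1)] by blast
qed


subsection \<open>Gaps and excesses along uniformly convergent nets\<close>

lemma setdist_le_infdist:
  "x \<in> S \<Longrightarrow> setdist S A \<le> infdist x A"
  using setdist_subset_left[of "{x}" S A] by (simp add: infdist_eq_setdist)

text \<open>The gap is the infimum of \<open>infdist x A\<close> over \<open>S\<close>; nonemptiness
  rules out the default value 0 of \<open>setdist {} A\<close>.\<close>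

lemma le_setdist_infdist:
  "S \<noteq> {} \<Longrightarrow> (\<And>x. x \<in> S \<Longrightarrow> c \<le> infdist x A) \<Longrightarrow> c \<le> setdist S A"
  by (auto simp: setdist_eq_infdist intro: cINF_greatest)

lemma infdist_less_excess:
  "x \<in> S \<Longrightarrow> excess S A < ereal c \<Longrightarrow> infdist x A < c"
  unfolding excess_def by (metis SUP_lessD less_ereal.simps(1))

lemma upper_conv_setdist:
  assumes "upper_conv \<S> F A L" "S \<in> \<S>" "S \<noteq> {}" "a < setdist S L"
  shows "\<forall>\<^sub>F i in F. a < setdist S (A i)"
proof -
  \<comment> \<open>Taking the infimum over \<open>S\<close> makes the estimate non-strict; spending
    only half of the slack leaves room for a strict inequality.\<close>
  define e where "e = (setdist S L - a) / 2"
  have "e > 0"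
    using assms(4) by (simp add: e_def)
  then have "\<forall>\<^sub>F i in F. \<forall>x\<in>S. infdist x L - infdist x (A i) < e"
    using assms unfolding upper_conv_def by blast
  then show ?thesis
  proof (rule eventually_mono)
    fix i assume *: "\<forall>x\<in>S. infdist x L - infdist x (A i) < e"
    have "setdist S L - e \<le> setdist S (A i)"
    proof (rule le_setdist_infdist[OF \<open>S \<noteq> {}\<close>])
      fix x assume "x \<in> S"
      with * setdist_le_infdist[OF this, of L] show "setdist S L - e \<le> infdist x (A i)"
        by force
    qed
    moreover have "a < setdist S L - e"
      using \<open>e > 0\<close> by (simp add: e_def field_simps)
    ultimately show "a < setdist S (A i)"
      by simp
  qed
qed

lemma upper_conv_excess:
  assumes "upper_conv \<S> F A L" "S \<in> \<S>" "a < excess S L"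
  shows "\<forall>\<^sub>F i in F. a < excess S (A i)"
proof -
  \<comment> \<open>A lower bound for a supremum needs just one point of \<open>S\<close>.\<close>
  obtain x where x: "x \<in> S" "a < ereal (infdist x L)"
    using assms(3) unfolding excess_def less_SUP_iff by blast
  \<comment> \<open>\<open>a\<close> may be infinite, so a real \<open>c\<close> is inserted to
    obtain a real tolerance \<open>infdist x L - c\<close>.\<close>
  obtain c where c: "a < ereal c" "c < infdist x L"
    using ereal_dense2[OF x(2)] by auto
  have "infdist x L - c > 0"
    using c by simp
  then have "\<forall>\<^sub>F i in F. \<forall>y\<in>S. infdist y L - infdist y (A i) < infdist x L - c"
    using assms unfolding upper_conv_def by blast
  then show ?thesis
  proof (rule eventually_mono)
    fix i assume "\<forall>y\<in>S. infdist y L - infdist y (A i) < infdist x L - c"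
    with x(1) have "c < infdist x (A i)"
      by force
    then have "a < ereal (infdist x (A i))"
      using c(1) by (meson less_ereal.simps(1) less_trans)
    also have "\<dots> \<le> excess S (A i)"
      unfolding excess_def using x(1) by (rule SUP_upper)
    finally show "a < excess S (A i)" .
  qed
qed

lemma lower_conv_setdist:
  assumes "lower_conv \<S> F A L" "S \<in> \<S>" "S \<noteq> {}" "setdist S L < a"
  shows "\<forall>\<^sub>F i in F. setdist S (A i) < a"
proof -
  obtain x where x: "x \<in> S" "infdist x L < a"
    using le_setdist_infdist[OF \<open>S \<noteq> {}\<close>, of a L] assms(4) by force
  then have "\<forall>\<^sub>F i in F. \<forall>y\<in>S. infdist y (A i) - infdist y L < a - infdist x L"
    using assms unfolding lower_conv_def by simp
  then show ?thesis
  proof (rule eventually_mono)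
    fix i assume "\<forall>y\<in>S. infdist y (A i) - infdist y L < a - infdist x L"
    with x(1) have "infdist x (A i) < a"
      by force
    with setdist_le_infdist[OF x(1), of "A i"] show "setdist S (A i) < a"
      by simp
  qed
qed

lemma lower_conv_excess:
  assumes "lower_conv \<S> F A L" "S \<in> \<S>" "excess S L < a"
  shows "\<forall>\<^sub>F i in F. excess S (A i) < a"
proof -
  \<comment> \<open>Two reals \<open>c < b\<close> fit between \<open>excess S L\<close> and
    \<open>a\<close>, even for infinite \<open>a\<close>. Distances to \<open>L\<close> on
    \<open>S\<close> lie below \<open>c\<close>, the error below \<open>b - c\<close>, so the
    supremum is at most \<open>b\<close>, still strictly below \<open>a\<close>.\<close>
  obtain b where b: "excess S L < ereal b" "ereal b < a"
    using ereal_dense2[OF assms(3)] by auto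
  obtain c where c: "excess S L < ereal c" "c < b"
    using ereal_dense2[OF b(1)] by auto
  have "b - c > 0"
    using c by simp
  then have "\<forall>\<^sub>F i in F. \<forall>x\<in>S. infdist x (A i) - infdist x L < b - c"
    using assms unfolding lower_conv_def by blast
  then show ?thesis
  proof (rule eventually_mono)
    fix i assume *: "\<forall>x\<in>S. infdist x (A i) - infdist x L < b - c"
    have "excess S (A i) \<le> ereal b"
      unfolding excess_def
    proof (rule SUP_least)
      fix x assume "x \<in> S"
      with * infdist_less_excess[OF this c(1)] show "ereal (infdist x (A i)) \<le> ereal b"
        by force
    qed
    then show "excess S (A i) < a"
      using b(2) by (rule le_less_trans)
  qed
qed


subsection \<open>Interpolation between Lipschitz enlargements\<close>

text \<open>The conclusion of (i) for fixed \<open>S\<close>, \<open>f\<close>, \<open>g\<close>,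
  kept literal so that it can be folded in the theorem. The bound \<open>n \<ge> 1\<close> makes the
  maximum range over a nonempty set.\<close>

definition interpolable ::
  "'a::metric_space set set \<Rightarrow> 'a set \<Rightarrow> ('a \<Rightarrow> real) \<Rightarrow> ('a \<Rightarrow> real) \<Rightarrow> bool" where
  "interpolable \<S> S f g \<longleftrightarrow>
     (\<exists>n\<ge>1. \<exists>(T :: nat \<Rightarrow> 'a set) (\<alpha> :: nat \<Rightarrow> real) (\<epsilon> :: nat \<Rightarrow> real).
        (\<forall>i\<in>{1..n}. T i \<in> \<S> \<and> 0 < \<alpha> i \<and> \<alpha> i < \<epsilon> i) \<and>
        ereal (MAX i\<in>{1..n}. 2 * \<epsilon> i) < (INF x\<in>S. ereal (g x - f x)) \<and>
        lipschitz_enlargement S f \<subseteq> (\<Union>i\<in>{1..n}. enlargement (T i) (\<alpha> i)) \<and>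
        (\<Union>i\<in>{1..n}. enlargement (T i) (\<alpha> i)) \<subseteq> (\<Union>i\<in>{1..n}. enlargement (T i) (\<epsilon> i)) \<and>
        (\<Union>i\<in>{1..n}. enlargement (T i) (\<epsilon> i)) \<subseteq> lipschitz_enlargement S g)"

text \<open>Both applications have constant \<open>g - f\<close>, so the infimum is that constant
  and bounds each \<open>2 * \<epsilon> i\<close> separately.\<close>

lemma interpolableE:
  assumes "interpolable \<S> S f g" "S \<noteq> {}" "\<And>x. x \<in> S \<Longrightarrow> g x - f x = c"
  obtains n :: nat and T \<alpha> \<epsilon>
  where "\<And>i. i \<in> {1..n} \<Longrightarrow> T i \<in> \<S> \<and> 0 < \<alpha> i \<and> \<alpha> i < \<epsilon> i \<and> 2 * \<epsilon> i < c"
    and "lipschitz_enlargement S f \<subseteq> (\<Union>i\<in>{1..n}. enlargement (T i) (\<alpha> i))"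
    and "(\<Union>i\<in>{1..n}. enlargement (T i) (\<epsilon> i)) \<subseteq> lipschitz_enlargement S g"
proof -
  obtain n :: nat and T \<alpha> \<epsilon> where *: "\<forall>i\<in>{1..n}. T i \<in> \<S> \<and> 0 < \<alpha> i \<and> \<alpha> i < \<epsilon> i"
      "ereal (MAX i\<in>{1..n}. 2 * \<epsilon> i) < (INF x\<in>S. ereal (g x - f x))"
      "lipschitz_enlargement S f \<subseteq> (\<Union>i\<in>{1..n}. enlargement (T i) (\<alpha> i))"
      "(\<Union>i\<in>{1..n}. enlargement (T i) (\<epsilon> i)) \<subseteq> lipschitz_enlargement S g"
    using assms(1) unfolding interpolable_def by (elim exE conjE) (rule that)
  have "(INF x\<in>S. ereal (g x - f x)) = (INF x\<in>S. ereal c)"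
    using assms(3) by simp
  also have "\<dots> = ereal c"
    using assms(2) by simp
  finally have max: "(MAX i\<in>{1..n}. 2 * \<epsilon> i) < c"
    using *(2) by simp
  have "2 * \<epsilon> i < c" if "i \<in> {1..n}" for i
  proof -
    have "2 * \<epsilon> i \<le> (MAX i\<in>{1..n}. 2 * \<epsilon> i)"
      using that by (intro Max_ge) auto
    with max show ?thesis
      by simp
  qed
  with * show ?thesis
    by (intro that[of n T \<alpha> \<epsilon>]) auto
qed

text \<open>One family covers all radius functions below: the upper half truncates at
  \<open>c = e\<close>, the lower half at \<open>c = 0\<close>, where truncation changes
  nothing.\<close>

lemma lipschitz_on_infdist_max:
  "1-lipschitz_on UNIV (\<lambda>x. max (infdist x L) c + k)"
proof (rule lipschitz_onI)
  fix x y
  show "dist (max (infdist x L) c + k) (max (infdist y L) c + k) \<le> 1 * dist x y"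
    using infdist_triangle_abs[of x L y] by (simp add: dist_real_def max_def abs_real_def split: if_splits)
qed simp

lemma positive_lipschitzI:
  assumes "c + k > 0"
  shows "(\<lambda>x. max (infdist x L) c + k) \<in> positive_lipschitz"
  unfolding positive_lipschitz_def mem_Collect_eq
proof (intro conjI exI allI)
  show "max (infdist x L) c + k > 0" for x
    using assms by linarith
qed (rule lipschitz_on_infdist_max)

lemma infdist_less_obtains:
  assumes "infdist x A < c" "A \<noteq> {}"
  obtains a where "a \<in> A" "dist x a < c"
  using assms by (auto simp: infdist_notempty cINF_less_iff)

section \<open>From gap and excess convergence back to uniform estimates\<close>

lemma gap_imp_upper_conv:
  assumes hered: "\<And>S T. S \<in> \<S> \<Longrightarrow> T \<subseteq> S \<Longrightarrow> T \<noteq> {} \<Longrightarrow> T \<in> \<S>"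
    and interp: "\<And>S f g. S \<in> \<S> \<Longrightarrow> f \<in> positive_lipschitz \<Longrightarrow> g \<in> positive_lipschitz \<Longrightarrow>
      0 < (INF x\<in>S. ereal (g x - f x)) \<Longrightarrow> interpolable \<S> S f g"
    and "L \<noteq> {}" and ne: "\<forall>\<^sub>F i in F. A i \<noteq> {}"
    and gap: "\<And>S a. S \<in> \<S> \<Longrightarrow> a < setdist S L \<Longrightarrow> \<forall>\<^sub>F i in F. a < setdist S (A i)"
  shows "upper_conv \<S> F A L"
  unfolding upper_conv_def
proof (intro allI impI ballI)
  fix e :: real and S assume "e > 0" "S \<in> \<S>"
  define S' where "S' = {x \<in> S. e \<le> infdist x L}"
  \<comment> \<open>On \<open>S - S'\<close> the distance to \<open>L\<close> is below
    \<open>e\<close>, and distances to \<open>A i\<close> are nonnegative.\<close>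
  have far: "infdist x L - infdist x (A i) < e" if "x \<in> S - S'" for x i
    using that infdist_nonneg[of x "A i"] by (auto simp: S'_def)
  show "\<forall>\<^sub>F i in F. \<forall>x\<in>S. infdist x L - infdist x (A i) < e"
  proof (cases "S' = {}")
    case True
    with far show ?thesis
      by simp
  next
    case False
    then have S': "S' \<in> \<S>"
      using hered[OF \<open>S \<in> \<S>\<close>, of S'] by (auto simp: S'_def)
    \<comment> \<open>Truncation at \<open>e\<close> keeps \<open>f \<ge> e/2\<close> on the whole
      space, as positivity requires; on \<open>S'\<close> it is inactive and \<open>g\<close> is the
      distance to \<open>L\<close>.\<close>
    define g where "g = (\<lambda>x. max (infdist x L) e + 0)"
    define f where "f = (\<lambda>x. max (infdist x L) e + - (e/2))"
    have c: "g x - f x = e/2" for x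
      by (simp add: f_def g_def)
    have "interpolable \<S> S' f g"
    proof (rule interp[OF S'])
      show "f \<in> positive_lipschitz" "g \<in> positive_lipschitz"
        unfolding f_def g_def by (rule positive_lipschitzI; use \<open>e > 0\<close> in simp)+
      show "0 < (INF x\<in>S'. ereal (g x - f x))"
        using \<open>e > 0\<close> False by (simp add: c)
    qed
    then obtain n :: nat and T \<alpha> \<epsilon>
      where T: "\<And>i. i \<in> {1..n} \<Longrightarrow> T i \<in> \<S> \<and> 0 < \<alpha> i \<and> \<alpha> i < \<epsilon> i \<and> 2 * \<epsilon> i < e/2"
        and f: "lipschitz_enlargement S' f \<subseteq> (\<Union>i\<in>{1..n}. enlargement (T i) (\<alpha> i))"
        and g: "(\<Union>i\<in>{1..n}. enlargement (T i) (\<epsilon> i)) \<subseteq> lipschitz_enlargement S' g"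
      by (rule interpolableE[OF _ False c]) (rule that)
    have disj: "a \<notin> lipschitz_enlargement S' g" if "a \<in> L" for a
    proof
      assume "a \<in> lipschitz_enlargement S' g"
      then obtain x where "x \<in> S'" "dist x a < g x"
        by (auto simp: lipschitz_enlargement_def)
      with infdist_le[OF that, of x] show False
        by (simp add: g_def S'_def)
    qed
    have "\<forall>\<^sub>F k in F. \<forall>i\<in>{1..n}. \<alpha> i < setdist (T i) (A k)"
    proof (intro eventually_ball_finite ballI gap)
      fix i assume i: "i \<in> {1..n}"
      \<comment> \<open>A point of \<open>L\<close> within \<open>\<epsilon> i\<close> of
        \<open>T i\<close> would lie in the enlargement by \<open>g\<close>, contradicting
        \<open>disj\<close>.\<close>
      have "\<epsilon> i \<le> setdist L (T i)"
      proof (rule le_setdist_infdist[OF \<open>L \<noteq> {}\<close>])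
        fix a assume "a \<in> L"
        with disj g i show "\<epsilon> i \<le> infdist a (T i)"
          by (force simp: enlargement_def)
      qed
      with T[OF i] show "\<alpha> i < setdist (T i) L"
        by (simp add: setdist_sym)
    qed (use T in auto)
    with ne show ?thesis
    proof eventually_elim
      case (elim k)
      have miss: "a \<notin> lipschitz_enlargement S' f" if "a \<in> A k" for a
      proof
        assume "a \<in> lipschitz_enlargement S' f"
        with f obtain i where "i \<in> {1..n}" "infdist a (T i) < \<alpha> i"
          by (auto simp: enlargement_def)
        with elim(2) setdist_le_infdist[OF that, of "T i"] show False
          by (force simp: setdist_sym)
      qed
      have "infdist x L - infdist x (A k) < e" if "x \<in> S'" for x
      proof -
        \<comment> \<open>A point of \<open>A k\<close> closer to \<open>x\<close> than
          \<open>f x\<close> would lie in the enlargement that \<open>A k\<close> misses. Since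
          \<open>f x \<ge> infdist x L - e/2\<close>, the loss is at most
          \<open>e/2\<close>.\<close>
        have "f x \<le> infdist x (A k)"
        proof (rule ccontr)
          assume "\<not> f x \<le> infdist x (A k)"
          then obtain a where "a \<in> A k" "dist x a < f x"
            using infdist_less_obtains[of x "A k" "f x"] elim(1) by auto
          with miss that show False
            by (auto simp: lipschitz_enlargement_def)
        qed
        with \<open>e > 0\<close> show ?thesis
          by (simp add: f_def)
      qed
      with far show ?case
        by blast
    qed
  qed
qed

lemma excess_imp_lower_conv:
  assumes "{} \<notin> \<S>" and hered: "\<And>S T. S \<in> \<S> \<Longrightarrow> T \<subseteq> S \<Longrightarrow> T \<noteq> {} \<Longrightarrow> T \<in> \<S>"
    and interp: "\<And>S f g. S \<in> \<S> \<Longrightarrow> f \<in> positive_lipschitz \<Longrightarrow> g \<in> positive_lipschitz \<Longrightarrow>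
      0 < (INF x\<in>S. ereal (g x - f x)) \<Longrightarrow> interpolable \<S> S f g"
    and "L \<noteq> {}" and ne: "\<forall>\<^sub>F i in F. A i \<noteq> {}"
    and exc: "\<And>S a. S \<in> \<S> \<Longrightarrow> excess S L < a \<Longrightarrow> \<forall>\<^sub>F i in F. excess S (A i) < a"
  shows "lower_conv \<S> F A L"
  unfolding lower_conv_def
proof (intro allI impI ballI)
  fix e :: real and S assume "e > 0" "S \<in> \<S>"
  with assms(1) have "S \<noteq> {}"
    by blast
  \<comment> \<open>The offsets differ by \<open>e/2\<close>, which forces
    \<open>2 * \<epsilon> i < e/2\<close>; the final bound \<open>f x + 2 * \<epsilon> i\<close> is
    then below \<open>infdist x L + 3*e/4\<close>.\<close>
  define g where "g = (\<lambda>x. max (infdist x L) 0 + 3*e/4)"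
  define f where "f = (\<lambda>x. max (infdist x L) 0 + e/4)"
  have f_eq: "f x = infdist x L + e/4" for x
    by (simp add: f_def infdist_nonneg)
  have c: "g x - f x = e/2" for x
    by (simp add: f_def g_def)
  have "interpolable \<S> S f g"
  proof (rule interp[OF \<open>S \<in> \<S>\<close>])
    show "f \<in> positive_lipschitz" "g \<in> positive_lipschitz"
      unfolding f_def g_def by (rule positive_lipschitzI; use \<open>e > 0\<close> in simp)+
    show "0 < (INF x\<in>S. ereal (g x - f x))"
      using \<open>e > 0\<close> \<open>S \<noteq> {}\<close> by (simp add: c)
  qed
  then obtain n :: nat and T \<alpha> \<epsilon>
    where T: "\<And>i. i \<in> {1..n} \<Longrightarrow> T i \<in> \<S> \<and> 0 < \<alpha> i \<and> \<alpha> i < \<epsilon> i \<and> 2 * \<epsilon> i < e/2"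
      and f: "lipschitz_enlargement S f \<subseteq> (\<Union>i\<in>{1..n}. enlargement (T i) (\<alpha> i))"
    by (rule interpolableE[OF _ \<open>S \<noteq> {}\<close> c]) (rule that)
  \<comment> \<open>\<open>T i\<close> may contain points far from \<open>L\<close>; the restriction
    brings its excess over \<open>L\<close> down to at most \<open>\<alpha> i\<close>.\<close>
  define T' where "T' i = {s \<in> T i. infdist s L < \<alpha> i}" for i
  \<comment> \<open>The guard is there because the excess hypothesis speaks of members of the
    bornology only, and the empty set is none.\<close>
  have "\<forall>\<^sub>F k in F. \<forall>i\<in>{1..n}. T' i \<noteq> {} \<longrightarrow> excess (T' i) (A k) < ereal (\<epsilon> i)"
  proof (intro eventually_ball_finite ballI)
    fix i assume i: "i \<in> {1..n}"
    have "excess (T' i) L \<le> ereal (\<alpha> i)"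
      unfolding excess_def by (rule SUP_least) (simp add: T'_def less_imp_le)
    also have "\<dots> < ereal (\<epsilon> i)"
      using T[OF i] by simp
    finally have "excess (T' i) L < ereal (\<epsilon> i)" .
    moreover have "T' i \<in> \<S>" if "T' i \<noteq> {}"
      using hered[of "T i" "T' i"] T[OF i] that by (auto simp: T'_def)
    ultimately show "\<forall>\<^sub>F k in F. T' i \<noteq> {} \<longrightarrow> excess (T' i) (A k) < ereal (\<epsilon> i)"
      using exc by (cases "T' i = {}") auto
  qed simp
  with ne show "\<forall>\<^sub>F i in F. \<forall>x\<in>S. infdist x (A i) - infdist x L < e"
  proof eventually_elim
    case (elim k)
    show ?case
    proof
      fix x assume "x \<in> S"
      obtain a where a: "a \<in> L" "dist x a < f x"
        using infdist_less_obtains[of x L "f x"] \<open>L \<noteq> {}\<close> \<open>e > 0\<close> by (auto simp: f_eq)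
      with \<open>x \<in> S\<close> f obtain i where i: "i \<in> {1..n}" "infdist a (T i) < \<alpha> i"
        by (force simp: lipschitz_enlargement_def enlargement_def)
      \<comment> \<open>\<open>infdist a {}\<close> is 0 by default, so smallness of
        \<open>infdist a (T i)\<close> alone would yield no nearby point.\<close>
      have "T i \<noteq> {}"
        using T[OF i(1)] assms(1) by auto
      then obtain s where s: "s \<in> T i" "dist a s < \<alpha> i"
        using infdist_less_obtains[OF i(2)] by blast
      have "infdist s L < \<alpha> i"
        using infdist_le[OF a(1), of s] s(2) by (simp add: dist_commute)
      with s(1) have "s \<in> T' i"
        by (simp add: T'_def)
      with elim(2) i(1) have "infdist s (A k) < \<epsilon> i"
        by (intro infdist_less_excess[of s "T' i"]) auto
      then obtain b where b: "b \<in> A k" "dist s b < \<epsilon> i"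
        using infdist_less_obtains elim(1) by blast
      have "infdist x (A k) \<le> dist x b"
        using b(1) by (rule infdist_le)
      also have "\<dots> \<le> dist x a + dist a s + dist s b"
        using dist_triangle[of x b s] dist_triangle[of x s a] by linarith
      also have "\<dots> < f x + 2 * \<epsilon> i"
        using a(2) s(2) b(2) T[OF i(1)] by linarith
      also have "\<dots> < infdist x L + e"
        using T[OF i(1)] \<open>e > 0\<close> by (simp add: f_eq)
      finally show "infdist x (A k) - infdist x L < e"
        by simp
    qed
  qed
qed

section \<open>The implications from (i) to (ii) and from (ii) to (iii)\<close>

theorem theorem4p20:
  fixes \<S> :: "'a::metric_space set set"
  assumes "bornology \<S>"
    and "\<And>S f. S \<in> \<S> \<Longrightarrow> f \<in> positive_lipschitz \<Longrightarrow> lipschitz_enlargement S f \<noteq> UNIV"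
  shows
    "((\<forall>S\<in>\<S>. \<forall>f\<in>positive_lipschitz. \<forall>g\<in>positive_lipschitz.
         0 < (INF x\<in>S. ereal (g x - f x)) \<longrightarrow>
         (\<exists>n\<ge>1. \<exists>(T :: nat \<Rightarrow> 'a set) (\<alpha> :: nat \<Rightarrow> real) (\<epsilon> :: nat \<Rightarrow> real).
            (\<forall>i\<in>{1..n}. T i \<in> \<S> \<and> 0 < \<alpha> i \<and> \<alpha> i < \<epsilon> i) \<and>
            ereal (MAX i\<in>{1..n}. 2 * \<epsilon> i) < (INF x\<in>S. ereal (g x - f x)) \<and>
            lipschitz_enlargement S f \<subseteq> (\<Union>i\<in>{1..n}. enlargement (T i) (\<alpha> i)) \<and>
            (\<Union>i\<in>{1..n}. enlargement (T i) (\<alpha> i)) \<subseteq> (\<Union>i\<in>{1..n}. enlargement (T i) (\<epsilon> i)) \<and>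
            (\<Union>i\<in>{1..n}. enlargement (T i) (\<epsilon> i)) \<subseteq> lipschitz_enlargement S g))
      \<longrightarrow>
      conv_eq TYPE('i) (upper_conv \<S>) (topology_conv (upper_gap_topology \<S>)) \<and>
      conv_eq TYPE('i) (lower_conv \<S>) (topology_conv (lower_excess_topology \<S>)))
     \<and>
     (conv_eq TYPE('i) (upper_conv \<S>) (topology_conv (upper_gap_topology \<S>)) \<and>
      conv_eq TYPE('i) (lower_conv \<S>) (topology_conv (lower_excess_topology \<S>))
      \<longrightarrow>
      conv_eq TYPE('i) (two_sided_conv \<S>) (topology_conv (gap_excess_topology \<S>)))"
  unfolding interpolable_def[symmetric]
proof (rule conjI; rule impI)
  have ne: "{} \<notin> \<S>" and hered: "\<And>S T. S \<in> \<S> \<Longrightarrow> T \<subseteq> S \<Longrightarrow> T \<noteq> {} \<Longrightarrow> T \<in> \<S>"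
    using assms(1) unfolding bornology_def by blast+
  {
    assume "\<forall>S\<in>\<S>. \<forall>f\<in>positive_lipschitz. \<forall>g\<in>positive_lipschitz.
      0 < (INF x\<in>S. ereal (g x - f x)) \<longrightarrow> interpolable \<S> S f g"
    then have interp: "interpolable \<S> S f g"
      if "S \<in> \<S>" "f \<in> positive_lipschitz" "g \<in> positive_lipschitz"
        "0 < (INF x\<in>S. ereal (g x - f x))" for S f g
      using that by blast
    show "conv_eq TYPE('i) (upper_conv \<S>) (topology_conv (upper_gap_topology \<S>)) \<and>
      conv_eq TYPE('i) (lower_conv \<S>) (topology_conv (lower_excess_topology \<S>))"
      unfolding conv_eq_def
    proof (intro conjI allI impI)
      fix I :: "'i set" and le and A :: "'i \<Rightarrow> 'a set" and L :: "'a set"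
      assume "directed_by I le" "\<forall>i\<in>I. A i \<in> CL" and L: "L \<in> CL"
      then have ev: "\<forall>\<^sub>F i in net_filter I le. A i \<in> CL"
        by (intro eventually_net_filter_CL)
      then have ev': "\<forall>\<^sub>F i in net_filter I le. A i \<noteq> {}"
        by (rule eventually_mono) (simp add: CL_def)
      have L': "L \<noteq> {}"
        using L by (simp add: CL_def)
      show "upper_conv \<S> (net_filter I le) A L \<longleftrightarrow>
        topology_conv (upper_gap_topology \<S>) (net_filter I le) A L"
        unfolding topology_conv_def limitin_upper_gap_topology[OF L ev]
      proof (intro iffI ballI allI impI)
        fix S a assume "upper_conv \<S> (net_filter I le) A L" "S \<in> \<S>" "a < setdist S L"
        with ne show "\<forall>\<^sub>F i in net_filter I le. a < setdist S (A i)"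
          by (metis upper_conv_setdist)
      next
        assume "\<forall>S\<in>\<S>. \<forall>a<setdist S L. \<forall>\<^sub>F i in net_filter I le. a < setdist S (A i)"
        then show "upper_conv \<S> (net_filter I le) A L"
          by (intro gap_imp_upper_conv[OF hered interp L' ev']) simp_all
      qed
      show "lower_conv \<S> (net_filter I le) A L \<longleftrightarrow>
        topology_conv (lower_excess_topology \<S>) (net_filter I le) A L"
        unfolding topology_conv_def limitin_lower_excess_topology[OF L ev]
      proof (intro iffI ballI allI impI)
        fix S a assume "lower_conv \<S> (net_filter I le) A L" "S \<in> \<S>" "excess S L < a"
        then show "\<forall>\<^sub>F i in net_filter I le. excess S (A i) < a"
          by (rule lower_conv_excess)
      next
        assume "\<forall>S\<in>\<S>. \<forall>a>excess S L. \<forall>\<^sub>F i in net_filter I le. excess S (A i) < a"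
        then show "lower_conv \<S> (net_filter I le) A L"
          by (intro excess_imp_lower_conv[OF ne hered interp L' ev']) simp_all
      qed
    qed
  next
    assume eq: "conv_eq TYPE('i) (upper_conv \<S>) (topology_conv (upper_gap_topology \<S>)) \<and>
      conv_eq TYPE('i) (lower_conv \<S>) (topology_conv (lower_excess_topology \<S>))"
    show "conv_eq TYPE('i) (two_sided_conv \<S>) (topology_conv (gap_excess_topology \<S>))"
      unfolding conv_eq_def
    proof (intro allI impI)
      fix I :: "'i set" and le and A :: "'i \<Rightarrow> 'a set" and L :: "'a set"
      assume dir: "directed_by I le" and A: "\<forall>i\<in>I. A i \<in> CL" and L: "L \<in> CL"
      let ?F = "net_filter I le"
      have ev: "\<forall>\<^sub>F i in ?F. A i \<in> CL"
        using dir A by (rule eventually_net_filter_CL)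
      \<comment> \<open>Through the topological criteria, (ii) becomes a pair of equivalences
        between uniform estimates and eventual strict inequalities.\<close>
      have upper: "upper_conv \<S> ?F A L \<longleftrightarrow>
          (\<forall>S\<in>\<S>. \<forall>a < setdist S L. \<forall>\<^sub>F i in ?F. a < setdist S (A i))"
        and lower: "lower_conv \<S> ?F A L \<longleftrightarrow>
          (\<forall>S\<in>\<S>. \<forall>a > excess S L. \<forall>\<^sub>F i in ?F. excess S (A i) < a)"
        using eq dir A L unfolding conv_eq_def topology_conv_def
          limitin_upper_gap_topology[OF L ev, symmetric]
          limitin_lower_excess_topology[OF L ev, symmetric] by blast+
      \<comment> \<open>Forwards, the two uniform estimates bound gap and excess from both sides.
        Backwards, the lower half of gap convergence and the upper half of excess convergence give
        the estimates by (ii).\<close>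
      have "two_sided_conv \<S> ?F A L \<longleftrightarrow>
        (\<forall>S\<in>\<S>. ((\<lambda>i. setdist S (A i)) \<longlongrightarrow> setdist S L) ?F \<and>
                ((\<lambda>i. excess S (A i)) \<longlongrightarrow> excess S L) ?F)" (is "_ \<longleftrightarrow> ?R")
      proof
        assume "two_sided_conv \<S> ?F A L"
        then have u: "upper_conv \<S> ?F A L" and l: "lower_conv \<S> ?F A L"
          by (simp_all add: two_sided_conv_def)
        show ?R
        proof (intro ballI conjI)
          fix S assume S: "S \<in> \<S>"
          with ne have "S \<noteq> {}"
            by blast
          with u l S show "((\<lambda>i. setdist S (A i)) \<longlongrightarrow> setdist S L) ?F"
            by (intro order_tendstoI upper_conv_setdist lower_conv_setdist)
          from u l S show "((\<lambda>i. excess S (A i)) \<longlongrightarrow> excess S L) ?F"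
            by (intro order_tendstoI upper_conv_excess lower_conv_excess)
        qed
      next
        assume ?R
        then show "two_sided_conv \<S> ?F A L"
          unfolding two_sided_conv_def upper lower by (auto dest: order_tendstoD)
      qed
      then show "two_sided_conv \<S> ?F A L \<longleftrightarrow>
        topology_conv (gap_excess_topology \<S>) ?F A L"
        unfolding topology_conv_def limitin_gap_excess_topology[OF L ev] .
    qed
  }
qed

end
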